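(* Let $V$ be a finite totally ordered set, let $Q$ be a partial quasi-pairing of $V$, and let $T:=\mathrm{Inv}(\underline{V},Q)$. Consider the following two assertions. (1) The set $\cup Q$ is a transversal of $\mathrm{mc}(\underline{V})$, and $Q$ is an irreducible quasi-pairing of $\cup Q$ (where $\cup Q$ is totally ordered by the order induced from $V$). (2) At least one of the tournaments $T$, $T-v_Q^-$, or $T-v_Q^+$ is indecomposable. If $|V|\geq 6$, then (1) and (2) are equivalent. Moreover, if $|V|=5$, then (2) implies (1).
   Context: All structures are finite. A tournament $T=(V(T),A(T))$ consists of a finite vertex set $V(T)$ and a set $A(T)$ of ordered pairs of distinct vertices (arcs) such that for all $x\neq y$ in $V(T)$, $(x,y)\in A(T)$ if and only if $(y,x)\notin A(T)$. For a vertex $v$, $T-v$ denotes the subtournament of $T$ induced by $V(T)\setminus\{v\}$. For a totally ordered set $V$, $\underline{V}$ denotes the transitive tournament $(V,\{(x,y)\in V\times V: x<y\})$. For $Q\subseteq \binom{V}{2}$ (a set of unordered pairs of distinct elements), $\mathrm{Inv}(\underline{V},Q)$ is the tournament on $V$ obtained from $\underline{V}$ by reversing every arc $(x,y)$ such that $\{x,y\}\in Q$; $\cup Q$ denotes the union of the pairs in $Q$. A module of a tournament $T$ is a subset $M\subseteq V(T)$ such that for every $v\in V(T)\setminus M$, either $\{v\}\times M\subseteq A(T)$ or $M\times\{v\}\subseteq A(T)$. The trivial modules are $\emptyset$, $V(T)$ and the singletons. $T$ is indecomposable if all its modules are trivial. A co-module of $T$ is a subset $M\subseteq V(T)$ such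 that $M$ or $V(T)\setminus M$ is a nontrivial module of $T$; it is minimal if it contains no other co-module. $\mathrm{mc}(T)$ denotes the family of minimal co-modules of $T$. A transversal of a family $\mathcal{F}$ of sets is a set $R$ with $R\cap F\neq\emptyset$ for every $F\in\mathcal{F}$. A quasi-pairing of a set $W$ of size $2m+1$ with $m\geq 1$ is a subset $Q\subseteq\binom{W}{2}$ with $|Q|=m+1$ and $\cup Q=W$. A partial quasi-pairing of $V$ is a quasi-pairing of some subset of $V$ (namely of $\cup Q$). In a quasi-pairing $Q$ exactly one element, denoted $\hat v_Q$, belongs to two pairs of $Q$ and every other element of $\cup Q$ belongs to exactly one pair; $v_Q^-<v_Q^+$ denote the two elements such that $\{\hat v_Q,v_Q^-\},\{\hat v_Q,v_Q^+\}\in Q$, and $B_Q:=\{\hat v_Q,v_Q^-,v_Q^+\}$. Let $Q_{\mathrm{part}}:=(Q\setminus\{\{\hat v_Q,v_Q^-\},\{\hat v_Q,v_Q^+\}\})\cup\{B_Q\}$, which is a partition of $\cup Q$. An interval of a totally ordered set $X$ is a subset $I\subseteq X$ such that every element of $X\setminus I$ is greater than all the elements of $I$ or smaller than all of them; it is nontrivial if it is neither $\emptyset$, nor a singleton, nor $X$. A partition of a totally ordered set $X$ is irreducible if no nontrivial interval of $X$ is a union of blocks. A quasi-pairing $Q$ of a totally ordered set $X$ is irreducible if the partition $Q_{\mathrm{part}}$ of $X$ is irreducible. *)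

theory Defs
  imports
    "Graph_Theory.Graph_Theory"
    "HOL-Library.Disjoint_Sets"
    "HOL-Library.Ramsey"
begin

section \<open>Tournaments, modules and co-modules\<close>

locale tournament = digraph T for T :: "('a, 'b) pre_digraph" +
  assumes dominates_iff:
    "\<lbrakk>x \<in> verts T; y \<in> verts T; x \<noteq> y\<rbrakk> \<Longrightarrow> x \<rightarrow>\<^bsub>T\<^esub> y \<longleftrightarrow> \<not> y \<rightarrow>\<^bsub>T\<^esub> x"

definition delete_vertex :: "('a, 'b) pre_digraph \<Rightarrow> 'a \<Rightarrow> ('a, 'b) pre_digraph" where
  "delete_vertex T v = T \<restriction> (verts T - {v})"

definition is_module :: "('a, 'b) pre_digraph \<Rightarrow> 'a set \<Rightarrow> bool" where
  "is_module T M \<longleftrightarrow> M \<subseteq> verts T \<and>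
     (\<forall>v \<in> verts T - M. (\<forall>x \<in> M. v \<rightarrow>\<^bsub>T\<^esub> x) \<or> (\<forall>x \<in> M. x \<rightarrow>\<^bsub>T\<^esub> v))"

definition nontrivial_module :: "('a, 'b) pre_digraph \<Rightarrow> 'a set \<Rightarrow> bool" where
  "nontrivial_module T M \<longleftrightarrow>
     is_module T M \<and> M \<noteq> {} \<and> M \<noteq> verts T \<and> \<not> is_singleton M"

definition indecomposable :: "('a, 'b) pre_digraph \<Rightarrow> bool" where
  "indecomposable T \<longleftrightarrow> (\<nexists>M. nontrivial_module T M)"

definition co_module :: "('a, 'b) pre_digraph \<Rightarrow> 'a set \<Rightarrow> bool" where
  "co_module T M \<longleftrightarrow> M \<subseteq> verts T \<and>
     (nontrivial_module T M \<or> nontrivial_module T (verts T - M))"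

definition mc :: "('a, 'b) pre_digraph \<Rightarrow> 'a set set" where
  "mc T = {M. co_module T M \<and> (\<nexists>N. co_module T N \<and> N \<subset> M)}"

definition transversal :: "'a set set \<Rightarrow> 'a set \<Rightarrow> bool" where
  "transversal \<F> R \<longleftrightarrow> (\<forall>F \<in> \<F>. R \<inter> F \<noteq> {})"

text \<open>A finite totally ordered set is a finite subset of a type of class \<^class>\<open>linorder\<close>.\<close>

definition transitive_tournament :: "'a::linorder set \<Rightarrow> 'a pair_pre_digraph" where
  "transitive_tournament V = \<lparr> pverts = V, parcs = {(x, y) \<in> V \<times> V. x < y} \<rparr>"

definition Inv :: "'a pair_pre_digraph \<Rightarrow> 'a set set \<Rightarrow> 'a pair_pre_digraph" where
  "Inv T Q = \<lparr> pverts = pverts T,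
     parcs = {(x, y) \<in> parcs T. {x, y} \<notin> Q} \<union> {(y, x) | x y. (x, y) \<in> parcs T \<and> {x, y} \<in> Q} \<rparr>"

lemma tournament_Inv_transitive:
  assumes "finite V"
  shows "tournament (with_proj (Inv (transitive_tournament V) Q))"
proof -
  let ?A = "parcs (Inv (transitive_tournament V) Q)"
  have A: "?A \<subseteq> V \<times> V"
    by (auto simp: Inv_def transitive_tournament_def)
  then have fin: "finite ?A"
    using assms by (meson finite_SigmaI finite_subset)
  have V: "pverts (Inv (transitive_tournament V) Q) = V"
    by (simp add: Inv_def transitive_tournament_def)
  have loop: "fst e \<noteq> snd e" if "e \<in> ?A" for e
    using that by (auto simp: Inv_def transitive_tournament_def)
  have total: "(x, y) \<in> ?A \<longleftrightarrow> (y, x) \<notin> ?A" if "x \<in> V" "y \<in> V" "x \<noteq> y" for x y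
    using that by (cases x y rule: linorder_cases)
      (auto simp: Inv_def transitive_tournament_def insert_commute)
  show ?thesis
  proof unfold_locales
    fix x y
    assume "x \<in> verts (with_proj (Inv (transitive_tournament V) Q))"
      "y \<in> verts (with_proj (Inv (transitive_tournament V) Q))" "x \<noteq> y"
    then show "(x, y) \<in> arcs_ends (with_proj (Inv (transitive_tournament V) Q)) \<longleftrightarrow>
        (y, x) \<notin> arcs_ends (with_proj (Inv (transitive_tournament V) Q))"
      unfolding with_proj_simps V by (rule total)
  qed (use assms A fin loop V in \<open>auto simp: arc_to_ends_def\<close>)
qed

section \<open>Intervals and irreducible partitions\<close>

definition interval_of :: "'a::linorder set \<Rightarrow> 'a set \<Rightarrow> bool" where
  "interval_of X I \<longleftrightarrow> I \<subseteq> X \<and> (\<forall>x \<in> X - I. (\<forall>i \<in> I. i < x) \<or> (\<forall>i \<in> I. x < i))"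

definition nontrivial_interval_of :: "'a::linorder set \<Rightarrow> 'a set \<Rightarrow> bool" where
  "nontrivial_interval_of X I \<longleftrightarrow>
     interval_of X I \<and> I \<noteq> {} \<and> \<not> is_singleton I \<and> I \<noteq> X"

definition irreducible_partition :: "'a::linorder set \<Rightarrow> 'a set set \<Rightarrow> bool" where
  "irreducible_partition X P \<longleftrightarrow> partition_on X P \<and>
     (\<nexists>I. nontrivial_interval_of X I \<and> (\<exists>\<B> \<subseteq> P. I = \<Union>\<B>))"

section \<open>Quasi-pairings\<close>

definition quasi_pairing :: "'a set \<Rightarrow> 'a set set \<Rightarrow> bool" where
  "quasi_pairing W Q \<longleftrightarrow> Q \<subseteq> [W]\<^bsup>2\<^esup> \<and> \<Union>Q = W \<and>
     (\<exists>m \<ge> 1. card W = 2 * m + 1 \<and> card Q = m + 1)"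

definition partial_quasi_pairing :: "'a set \<Rightarrow> 'a set set \<Rightarrow> bool" where
  "partial_quasi_pairing V Q \<longleftrightarrow> (\<exists>W \<subseteq> V. quasi_pairing W Q)"

text \<open>
  The following descriptions are meaningful for quasi-pairings only; see
  \<open>quasi_pairing_v_hat\<close> and \<open>quasi_pairing_v_minus_plus\<close> below.
\<close>

definition v_hat :: "'a set set \<Rightarrow> 'a" where
  "v_hat Q = (THE v. card {p \<in> Q. v \<in> p} = 2)"

definition v_minus :: "'a::linorder set set \<Rightarrow> 'a" where
  "v_minus Q = (THE x. \<exists>y. x < y \<and> {v_hat Q, x} \<in> Q \<and> {v_hat Q, y} \<in> Q)"

definition v_plus :: "'a::linorder set set \<Rightarrow> 'a" where
  "v_plus Q = (THE y. \<exists>x. x < y \<and> {v_hat Q, x} \<in> Q \<and> {v_hat Q, y} \<in> Q)"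

definition B_block :: "'a::linorder set set \<Rightarrow> 'a set" where
  "B_block Q = {v_hat Q, v_minus Q, v_plus Q}"

definition Q_part :: "'a::linorder set set \<Rightarrow> 'a set set" where
  "Q_part Q = (Q - {{v_hat Q, v_minus Q}, {v_hat Q, v_plus Q}}) \<union> {B_block Q}"

definition irreducible_quasi_pairing :: "'a::linorder set \<Rightarrow> 'a set set \<Rightarrow> bool" where
  "irreducible_quasi_pairing X Q \<longleftrightarrow> quasi_pairing X Q \<and> irreducible_partition X (Q_part Q)"

lemma quasi_pairing_v_hat:
  assumes "quasi_pairing W Q"
  shows "v_hat Q \<in> W" "card {p \<in> Q. v_hat Q \<in> p} = 2"
    "\<And>v. v \<in> W \<Longrightarrow> v \<noteq> v_hat Q \<Longrightarrow> card {p \<in> Q. v \<in> p} = 1"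
proof -
  obtain m where m: "card W = 2 * m + 1" "card Q = m + 1"
    and Q: "Q \<subseteq> [W]\<^bsup>2\<^esup>" "\<Union>Q = W"
    using assms by (auto simp: quasi_pairing_def)
  have fin: "finite W" "finite Q"
    using m by (simp_all add: card_ge_0_finite)
  let ?d = "\<lambda>v. card {p \<in> Q. v \<in> p}"
  have pos: "?d v \<ge> 1" if "v \<in> W" for v
    using that Q(2) fin by (auto simp: Suc_le_eq card_gt_0_iff)
  have "(\<Sum>v\<in>W. ?d v) = (\<Sum>v\<in>W. \<Sum>p\<in>Q. if v \<in> p then 1 else 0)"
    using fin by (simp add: sum.If_cases Int_def conj_commute)
  also have "\<dots> = (\<Sum>p\<in>Q. \<Sum>v\<in>W. if v \<in> p then 1 else 0)"
    by (rule sum.swap)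
  also have "\<dots> = (\<Sum>p\<in>Q. 2)"
  proof (rule sum.cong)
    fix p assume "p \<in> Q"
    then have "W \<inter> p = p" "card p = 2"
      using Q by (auto simp: nsets_def)
    then show "(\<Sum>v\<in>W. if v \<in> p then 1 else 0) = (2::nat)"
      using fin by (simp add: sum.If_cases)
  qed simp
  finally have total: "(\<Sum>v\<in>W. ?d v) = 2 * m + 2"
    using m by simp
  have "(\<Sum>v\<in>W. ?d v) = (\<Sum>v\<in>W. (?d v - 1) + 1)"
    using pos by (intro sum.cong refl) (metis le_add_diff_inverse2)
  then have "(\<Sum>v\<in>W. ?d v - 1) = 1"
    using total m by (simp only: sum.distrib) simp
  then obtain h where h: "h \<in> W" "?d h - 1 = 1" "\<And>v. v \<in> W \<Longrightarrow> h \<noteq> v \<Longrightarrow> ?d v - 1 = 0"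
    using sum_eq_1_iff[OF fin(1), of "\<lambda>v. ?d v - 1"] by auto
  have one: "?d v = 1" if "v \<in> W" "v \<noteq> h" for v
    using pos[OF that(1)] h(3)[OF that(1)] that(2) by simp
  have two: "?d h = 2"
    using h(2) by simp
  have out: "?d v = 0" if "v \<notin> W" for v
  proof -
    have "{p \<in> Q. v \<in> p} = {}"
      using that Q(2) by blast
    then show ?thesis by (simp only: card.empty)
  qed
  have "v_hat Q = h"
    unfolding v_hat_def
  proof (rule the_equality)
    fix v assume "?d v = 2"
    then show "v = h"
      using one[of v] out[of v] by (cases "v \<in> W") auto
  qed (rule two)
  then show "v_hat Q \<in> W" "?d (v_hat Q) = 2"
    "\<And>v. v \<in> W \<Longrightarrow> v \<noteq> v_hat Q \<Longrightarrow> ?d v = 1"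
    using h(1) two one by auto
qed

lemma quasi_pairing_v_minus_plus:
  assumes "quasi_pairing W Q"
  shows "v_minus Q < v_plus Q"
    "{p \<in> Q. v_hat Q \<in> p} = {{v_hat Q, v_minus Q}, {v_hat Q, v_plus Q}}"
    "v_minus Q \<noteq> v_hat Q" "v_plus Q \<noteq> v_hat Q"
proof -
  let ?h = "v_hat Q"
  have Q: "card p = 2" if "p \<in> Q" for p
    using that assms by (auto simp: quasi_pairing_def nsets_def)
  have other: "\<exists>x. p = {?h, x} \<and> x \<noteq> ?h" if "p \<in> Q" "?h \<in> p" for p
    using Q[OF that(1)] that(2) by (auto simp: card_2_iff)
  obtain p q where pq: "p \<noteq> q" "{p \<in> Q. ?h \<in> p} = {p, q}"
    using quasi_pairing_v_hat(2)[OF assms] by (auto simp: card_2_iff)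
  then have pq': "p \<in> Q" "?h \<in> p" "q \<in> Q" "?h \<in> q" by blast+
  obtain a b where p: "p = {?h, a}" "a \<noteq> ?h" and q: "q = {?h, b}" "b \<noteq> ?h"
    using other pq' by metis
  have "\<exists>x y. x < y \<and> {p \<in> Q. ?h \<in> p} = {{?h, x}, {?h, y}} \<and> x \<noteq> ?h \<and> y \<noteq> ?h"
  proof (cases a b rule: linorder_cases)
    case equal
    then show ?thesis using pq(1) p q by simp
  next
    case less
    then show ?thesis using pq(2) p q by (intro exI[of _ a] exI[of _ b]) simp
  next
    case greater
    then show ?thesis using pq(2) p q by (intro exI[of _ b] exI[of _ a]) (simp add: insert_commute)
  qed
  then obtain x y where xy: "x < y" "{p \<in> Q. ?h \<in> p} = {{?h, x}, {?h, y}}" "x \<noteq> ?h" "y \<noteq> ?h"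
    by blast
  have mem: "{?h, z} \<in> Q \<longleftrightarrow> z = x \<or> z = y" for z
  proof -
    have "{?h, z} \<in> Q \<longleftrightarrow> {?h, z} \<in> {{?h, x}, {?h, y}}"
      by (simp flip: xy(2))
    also have "\<dots> \<longleftrightarrow> z = x \<or> z = y"
      using xy(3,4) by (auto simp: doubleton_eq_iff)
    finally show ?thesis .
  qed
  have "v_minus Q = x" "v_plus Q = y"
    unfolding v_minus_def v_plus_def mem using xy(1) by (auto intro!: the_equality)
  then show "v_minus Q < v_plus Q"
    "{p \<in> Q. ?h \<in> p} = {{?h, v_minus Q}, {?h, v_plus Q}}"
    "v_minus Q \<noteq> ?h" "v_plus Q \<noteq> ?h"
    using xy by auto
qed

end

theory Submission
  imports Defs
begin

text \<open>
  View \<open>Q\<close> as a graph on \<open>V\<close>. Assertion (1) says exactly that no nontrivial interval of \<open>V\<close> is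
  sealed, that is, without an edge leaving it. A sealed interval is a module of \<open>T\<close>, and stays a
  nontrivial one after deleting \<open>v\<^sup>-\<close> or \<open>v\<^sup>+\<close>; this gives (2) \<open>\<Longrightarrow>\<close> (1).

  For the converse, let \<open>M\<close> be a module. Every vertex outside \<open>M\<close> is adjacent to precisely those
  elements of \<open>M\<close> that lie on one side of it, so a vertex in a gap of \<open>M\<close> is adjacent to the least
  or to the greatest element of \<open>M\<close>, and few gaps are possible. If the graph is a matching and
  \<open>|V| \<ge> 5\<close>, this excludes all nontrivial modules. If two of \<open>v\<^sup>-\<close>, \<open>v\<^sup>+\<close> and the hub \<open>h\<close> are
  consecutive in \<open>V\<close>, then one of \<open>v\<^sup>-\<close>, \<open>v\<^sup>+\<close> can be deleted without creating sealed intervals,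
  leaving a matching. Otherwise a nontrivial module of \<open>T\<close> forces four consecutive vertices
  \<open>x < g < h < m\<close> (or their mirror image) with edges \<open>x h\<close> and \<open>g m\<close>, where \<open>x\<close> is \<open>v\<^sup>-\<close> or
  \<open>v\<^sup>+\<close>; again \<open>x\<close> can be deleted.
\<close>

section \<open>Modules and sealed intervals of an ordered graph\<close>

text \<open>
  An arc joins \<open>u\<close> to \<open>v\<close> when exactly one of \<open>L u v\<close>, \<open>E u v\<close> holds. Hence \<open>v\<close> dominates \<open>M\<close> iff
  its neighbours in \<open>M\<close> are the elements below it, and is dominated by \<open>M\<close> iff they are those above.
  The order is a parameter so that statements can be transferred to the reversed order.
\<close>

definition nt_module :: "'a set \<Rightarrow> ('a \<Rightarrow> 'a \<Rightarrow> bool) \<Rightarrow> ('a \<Rightarrow> 'a \<Rightarrow> bool) \<Rightarrow> 'a set \<Rightarrow> bool" where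
  "nt_module V L E M \<longleftrightarrow> M \<subseteq> V \<and> M \<noteq> {} \<and> M \<noteq> V \<and> \<not> is_singleton M \<and>
     (\<forall>v \<in> V - M. (\<forall>m \<in> M. E v m \<longleftrightarrow> L m v) \<or> (\<forall>m \<in> M. E v m \<longleftrightarrow> L v m))"

definition sealed :: "'a set \<Rightarrow> ('a \<Rightarrow> 'a \<Rightarrow> bool) \<Rightarrow> ('a \<Rightarrow> 'a \<Rightarrow> bool) \<Rightarrow> 'a set \<Rightarrow> bool" where
  "sealed V L E I \<longleftrightarrow> I \<subseteq> V \<and> I \<noteq> {} \<and> I \<noteq> V \<and> \<not> is_singleton I \<and>
     (\<forall>x \<in> V - I. (\<forall>i \<in> I. L i x) \<or> (\<forall>i \<in> I. L x i)) \<and> (\<forall>u \<in> I. \<forall>w \<in> V - I. \<not> E u w)"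

text \<open>The formula leaves open which of the two vertices is lower, so it is symmetric and
  survives reversal of the order.\<close>

definition consecutive :: "'a set \<Rightarrow> ('a \<Rightarrow> 'a \<Rightarrow> bool) \<Rightarrow> 'a \<Rightarrow> 'a \<Rightarrow> bool" where
  "consecutive V L x y \<longleftrightarrow> (\<forall>z \<in> V - {x, y}. L z x \<longleftrightarrow> L z y)"

lemma nt_module_dual: "nt_module V (\<lambda>x y. L y x) E M \<longleftrightarrow> nt_module V L E M"
  unfolding nt_module_def by blast

lemma sealed_dual: "sealed V (\<lambda>x y. L y x) E I \<longleftrightarrow> sealed V L E I"
  unfolding sealed_def by blast

locale ordered_graph =
  fixes V :: "'a set" and L :: "'a \<Rightarrow> 'a \<Rightarrow> bool" (infix "\<sqsubset>" 50) and E :: "'a \<Rightarrow> 'a \<Rightarrow> bool"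
  assumes finite_V: "finite V"
    and asym: "x \<sqsubset> y \<Longrightarrow> \<not> y \<sqsubset> x"
    and trans: "x \<sqsubset> y \<Longrightarrow> y \<sqsubset> z \<Longrightarrow> x \<sqsubset> z"
    and total: "x \<noteq> y \<Longrightarrow> x \<sqsubset> y \<or> y \<sqsubset> x"
    and E_sym: "E u v \<Longrightarrow> E v u"
begin

lemma irrefl: "\<not> x \<sqsubset> x"
  using asym by blast

lemma ordered_graph_dual: "ordered_graph V (\<lambda>x y. y \<sqsubset> x) E"
  using finite_V asym trans total E_sym by unfold_locales blast+

lemma ordered_graph_delete: "ordered_graph (V - {x}) L E"
  using finite_V asym trans total E_sym by unfold_locales blast+

lemma consecutive_dual: "consecutive V (\<lambda>x y. y \<sqsubset> x) x y \<longleftrightarrow> consecutive V L x y"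
proof -
  have "(x \<sqsubset> z \<longleftrightarrow> y \<sqsubset> z) \<longleftrightarrow> (z \<sqsubset> x \<longleftrightarrow> z \<sqsubset> y)" if "z \<noteq> x" "z \<noteq> y" for z
    using that asym total by metis
  then show ?thesis unfolding consecutive_def by blast
qed

lemma ex_min:
  assumes "finite A" "A \<noteq> {}"
  shows "\<exists>m \<in> A. \<forall>x \<in> A. x \<noteq> m \<longrightarrow> m \<sqsubset> x"
  using assms
proof (induction A rule: finite_ne_induct)
  case (insert x F)
  then obtain m where m: "m \<in> F" "\<forall>y \<in> F. y \<noteq> m \<longrightarrow> m \<sqsubset> y" by blast
  show ?case
  proof (cases "x \<sqsubset> m")
    case True
    then have "\<forall>y \<in> insert x F. y \<noteq> x \<longrightarrow> x \<sqsubset> y" using m trans by (metis insert_iff)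
    then show ?thesis by blast
  next
    case False
    then have "\<forall>y \<in> insert x F. y \<noteq> m \<longrightarrow> m \<sqsubset> y" using m total by (metis insert_iff)
    then show ?thesis using m by blast
  qed
qed simp

lemma ex_max:
  assumes "finite A" "A \<noteq> {}"
  shows "\<exists>m \<in> A. \<forall>x \<in> A. x \<noteq> m \<longrightarrow> x \<sqsubset> m"
  using ordered_graph.ex_min[OF ordered_graph_dual assms] .

lemma module_extremes:
  assumes "nt_module V L E M"
  obtains lo hi where "lo \<in> M" "hi \<in> M" "lo \<sqsubset> hi"
    "\<And>x. x \<in> M \<Longrightarrow> x \<noteq> lo \<Longrightarrow> lo \<sqsubset> x" "\<And>x. x \<in> M \<Longrightarrow> x \<noteq> hi \<Longrightarrow> x \<sqsubset> hi"
proof -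
  have M: "M \<subseteq> V" "M \<noteq> {}" "\<not> is_singleton M" using assms by (auto simp: nt_module_def)
  then have fin: "finite M" using finite_V finite_subset by blast
  obtain lo where lo: "lo \<in> M" "\<forall>x \<in> M. x \<noteq> lo \<longrightarrow> lo \<sqsubset> x" using ex_min[OF fin M(2)] by blast
  obtain hi where hi: "hi \<in> M" "\<forall>x \<in> M. x \<noteq> hi \<longrightarrow> x \<sqsubset> hi" using ex_max[OF fin M(2)] by blast
  have "lo \<noteq> hi"
  proof
    assume "lo = hi"
    then have "M = {lo}" using lo hi asym by blast
    then show False using M(3) by simp
  qed
  then show ?thesis using that lo hi by blast
qed

section \<open>Building sealed intervals\<close>

text \<open>Used contrapositively: when no interval is sealed and \<open>lo\<close>,
  \<open>hi\<close> are not the two ends of \<open>V\<close>, some edge leaves the hull between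
  them. Here \<open>lo\<close> and \<open>hi\<close> prevent a singleton, and \<open>z\<close>
  prevents the hull from being \<open>V\<close>.\<close>

lemma sealed_hull:
  assumes "lo \<in> V" "hi \<in> V" "lo \<sqsubset> hi" "z \<in> V" "z \<sqsubset> lo \<or> hi \<sqsubset> z"
    and "\<And>u w. \<lbrakk>u \<in> V; w \<in> V; \<not> u \<sqsubset> lo; \<not> hi \<sqsubset> u; w \<sqsubset> lo \<or> hi \<sqsubset> w\<rbrakk> \<Longrightarrow> \<not> E u w"
  shows "sealed V L E {u \<in> V. \<not> u \<sqsubset> lo \<and> \<not> hi \<sqsubset> u}"
proof -
  let ?U = "{u \<in> V. \<not> u \<sqsubset> lo \<and> \<not> hi \<sqsubset> u}"
  have lh: "lo \<in> ?U" "hi \<in> ?U" "lo \<noteq> hi" using assms asym by auto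
  have "\<not> is_singleton ?U"
    using lh by (metis is_singletonE singletonD)
  moreover have "(\<forall>i \<in> ?U. i \<sqsubset> x) \<or> (\<forall>i \<in> ?U. x \<sqsubset> i)" if "x \<in> V - ?U" for x
    using that trans total by (smt (verit) DiffE mem_Collect_eq)
  moreover have "?U \<noteq> V" using assms by blast
  moreover have "\<not> E u w" if "u \<in> ?U" "w \<in> V - ?U" for u w using assms(6) that by blast
  ultimately show ?thesis unfolding sealed_def using lh by blast
qed

text \<open>The deleted vertex \<open>x\<close> can be put back on the side of \<open>J\<close>
  where \<open>g\<close> and \<open>h\<close> both lie. Its only possible edge goes to
  \<open>h\<close>, so no edge crosses, and being next to \<open>g\<close> it does not break the
  interval.\<close>

lemma sealed_delete:
  assumes J: "sealed (V - {x}) L E J" and x: "x \<in> V" "\<And>u. u \<in> V \<Longrightarrow> E u x \<Longrightarrow> u = h"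
    and g: "g \<in> V" "g \<noteq> x" "consecutive V L x g" "g \<in> J \<longleftrightarrow> h \<in> J"
  shows "\<exists>I. sealed V L E I"
proof (cases "g \<in> J")
  case True
  let ?I = "insert x J"
  have J': "J \<subseteq> V - {x}" "J \<noteq> {}" "J \<noteq> V - {x}" using J by (auto simp: sealed_def)
  have "\<not> is_singleton ?I" using True g(2) by (metis insert_iff is_singletonE singletonD)
  moreover have "(\<forall>i \<in> ?I. i \<sqsubset> z) \<or> (\<forall>i \<in> ?I. z \<sqsubset> i)" if "z \<in> V - ?I" for z
  proof -
    have z: "z \<in> V - {x} - J" "z \<in> V - {x, g}" using that True by auto
    then have "(\<forall>i \<in> J. i \<sqsubset> z) \<or> (\<forall>i \<in> J. z \<sqsubset> i)" using J unfolding sealed_def by blast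
    moreover have "z \<sqsubset> x \<longleftrightarrow> z \<sqsubset> g" using g(3) z(2) unfolding consecutive_def by blast
    ultimately show ?thesis using True total asym z(2) by (metis Diff_iff insert_iff)
  qed
  moreover have "\<not> E u w" if "u \<in> ?I" "w \<in> V - ?I" for u w
    using that J x(2)[of w] E_sym g(4) True unfolding sealed_def by blast
  ultimately have "sealed V L E ?I" unfolding sealed_def using J' x(1) by blast
  then show ?thesis ..
next
  case False
  have J': "J \<subseteq> V - {x}" "J \<noteq> {}" "\<not> is_singleton J" using J by (auto simp: sealed_def)
  have "(\<forall>i \<in> J. i \<sqsubset> z) \<or> (\<forall>i \<in> J. z \<sqsubset> i)" if "z \<in> V - J" for z
  proof (cases "z = x")
    case True
    have "(\<forall>i \<in> J. i \<sqsubset> g) \<or> (\<forall>i \<in> J. g \<sqsubset> i)"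
      using J False g(1,2) unfolding sealed_def by blast
    moreover have "i \<sqsubset> x \<longleftrightarrow> i \<sqsubset> g" "i \<noteq> x" "i \<noteq> g" if "i \<in> J" for i
      using g(3) that False J' unfolding consecutive_def by blast+
    ultimately show ?thesis using True total asym by metis
  next
    case False
    then show ?thesis using J that unfolding sealed_def by blast
  qed
  moreover have "\<not> E u w" if "u \<in> J" "w \<in> V - J" for u w
    using that J J' x(2)[of u] g(4) False unfolding sealed_def by blast
  ultimately have "sealed V L E J" unfolding sealed_def using J' x(1) by blast
  then show ?thesis ..
qed

section \<open>Modules of matchings\<close>

text \<open>The vertex \<open>v\<close> is adjacent to everything of \<open>M\<close> below it, and
  \<open>lo\<close> is already its single neighbour. It turns out that \<open>v\<close> is the
  immediate successor of \<open>lo\<close>, the least vertex, so the edge between them is a sealed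
  interval.\<close>

lemma matching_no_left:
  assumes M: "nt_module V L E M" and card: "card V \<ge> 3" "card M \<ge> 3"
    and irr: "\<And>I. \<not> sealed V L E I"
    and matching: "\<And>u v w. \<lbrakk>u \<in> V; v \<in> V; w \<in> V; E u v; E u w\<rbrakk> \<Longrightarrow> v = w"
    and lo: "lo \<in> M" "\<And>x. x \<in> V \<Longrightarrow> x \<noteq> lo \<Longrightarrow> lo \<sqsubset> x"
    and hi: "hi \<in> M" "\<And>x. x \<in> V \<Longrightarrow> x \<noteq> hi \<Longrightarrow> x \<sqsubset> hi"
    and v: "v \<in> V - M" "\<forall>m \<in> M. E v m \<longleftrightarrow> m \<sqsubset> v"
  shows False
proof -
  have MV: "M \<subseteq> V" using M by (simp add: nt_module_def)
  have vlo: "E v lo" "v \<noteq> lo" using v lo MV by blast+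
  have below: "m = lo" if "m \<in> M" "m \<sqsubset> v" for m using that v vlo matching lo MV by blast
  \<comment> \<open>A vertex \<open>z\<close> between \<open>lo\<close> and \<open>v\<close> would
    be adjacent either to \<open>lo\<close>, which is matched to \<open>v\<close>, or to all of
    \<open>M\<close> above it; the latter leaves only \<open>lo\<close> and \<open>hi\<close> in
    \<open>M\<close>.\<close>
  have above: "v \<sqsubset> z" if z: "z \<in> V" "z \<noteq> lo" "z \<noteq> v" for z
  proof (rule ccontr)
    assume "\<not> v \<sqsubset> z"
    then have zv: "z \<sqsubset> v" using total z by blast
    then have "z \<notin> M" using below z by blast
    then consider "\<forall>m \<in> M. E z m \<longleftrightarrow> m \<sqsubset> z" | "\<forall>m \<in> M. E z m \<longleftrightarrow> z \<sqsubset> m"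
      using M z unfolding nt_module_def by blast
    then show False
    proof cases
      case 1
      then have "E z lo" using lo z by blast
      then show False using vlo matching[of lo z v] E_sym z lo MV v by blast
    next
      case 2
      have "m = lo \<or> m = hi" if m: "m \<in> M" for m
      proof (cases "z \<sqsubset> m")
        case True
        moreover have "z \<sqsubset> hi" using hi z \<open>z \<notin> M\<close> by blast
        ultimately show ?thesis using 2 m hi matching[of z m hi] z MV by blast
      next
        case False
        then have "m \<sqsubset> v" using total[of z m] trans[of m z v] zv m \<open>z \<notin> M\<close> by blast
        then show ?thesis using below m by blast
      qed
      then have "card M \<le> card {lo, hi}" by (intro card_mono) auto
      also have "\<dots> \<le> 2" by (simp add: card_insert_if)
      finally show False using card by simp
    qed
  qed
  have "sealed V L E {lo, v}"
    unfolding sealed_def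
  proof (intro conjI ballI)
    show "{lo, v} \<subseteq> V" using lo v MV by blast
    have "card {lo, v} = 2" using vlo by simp
    then show "{lo, v} \<noteq> V" "\<not> is_singleton {lo, v}" using card by (auto simp: is_singleton_altdef)
    show "(\<forall>i \<in> {lo, v}. i \<sqsubset> x) \<or> (\<forall>i \<in> {lo, v}. x \<sqsubset> i)" if "x \<in> V - {lo, v}" for x
      using that above lo by blast
    show "\<not> E u w" if "u \<in> {lo, v}" "w \<in> V - {lo, v}" for u w
      using that vlo matching[of u w] E_sym lo v MV by blast
  qed simp
  then show False using irr by blast
qed

text \<open>A module must reach both ends of \<open>V\<close>, since otherwise an edge leaving its
  hull creates a vertex of degree two. Then each vertex outside \<open>M\<close> is adjacent to an
  end of \<open>M\<close>, so at most two are outside. With five vertices this leaves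
  \<open>card M \<ge> 3\<close>, as \<open>matching_no_left\<close> requires.\<close>

lemma matching_no_module:
  assumes card: "card V \<ge> 5"
    and irr: "\<And>I. \<not> sealed V L E I"
    and matching: "\<And>u v w. \<lbrakk>u \<in> V; v \<in> V; w \<in> V; E u v; E u w\<rbrakk> \<Longrightarrow> v = w"
  shows "\<not> nt_module V L E M"
proof
  assume M: "nt_module V L E M"
  then have MV: "M \<subseteq> V" "M \<noteq> V" and
    ty: "\<And>v. v \<in> V - M \<Longrightarrow> (\<forall>m \<in> M. E v m \<longleftrightarrow> m \<sqsubset> v) \<or> (\<forall>m \<in> M. E v m \<longleftrightarrow> v \<sqsubset> m)"
    by (auto simp: nt_module_def)
  obtain lo hi where lh: "lo \<in> M" "hi \<in> M" "lo \<sqsubset> hi"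
    and lo: "\<And>x. x \<in> M \<Longrightarrow> x \<noteq> lo \<Longrightarrow> lo \<sqsubset> x" and hi: "\<And>x. x \<in> M \<Longrightarrow> x \<noteq> hi \<Longrightarrow> x \<sqsubset> hi"
    using module_extremes[OF M] by metis
  have VM: "\<not> z \<sqsubset> lo \<and> \<not> hi \<sqsubset> z" if "z \<in> V" for z
  proof (rule ccontr)
    assume "\<not> (\<not> z \<sqsubset> lo \<and> \<not> hi \<sqsubset> z)"
    moreover have "\<not> E u w"
      if uw: "u \<in> V" "w \<in> V" "\<not> u \<sqsubset> lo" "\<not> hi \<sqsubset> u" "w \<sqsubset> lo \<or> hi \<sqsubset> w" for u w
    proof
      assume uwE: "E u w"
      have wM: "w \<notin> M" using uw(5) lo hi asym by blast
      show False
      proof (cases "u \<in> M")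
        case True
        \<comment> \<open>All of \<open>M\<close> lies on one side of \<open>w\<close>, so
          \<open>w\<close> is adjacent to all of \<open>M\<close> or to none of it; the neighbour
          \<open>u\<close> excludes the second.\<close>
        have "E w lo" "E w hi"
          using ty[of w] wM uw E_sym[OF uwE] True lh lo hi asym trans by (metis DiffI)+
        then show False using matching[of w lo hi] lh MV uw irrefl by blast
      next
        case False
        \<comment> \<open>Here \<open>u\<close> sits in a gap of \<open>M\<close>, with
          \<open>lo\<close> below and \<open>hi\<close> above it.\<close>
        then have "E u lo \<or> E u hi"
          using ty[of u] uw lh total by (metis DiffI)
        then show False using matching[of u w] uwE wM lh MV uw by blast
      qed
    qed
    ultimately have "sealed V L E {u \<in> V. \<not> u \<sqsubset> lo \<and> \<not> hi \<sqsubset> u}"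
      using sealed_hull[of lo hi z] lh MV that by blast
    then show False using irr by blast
  qed
  have lo': "lo \<sqsubset> x" if "x \<in> V" "x \<noteq> lo" for x using VM that total by blast
  have hi': "x \<sqsubset> hi" if "x \<in> V" "x \<noteq> hi" for x using VM that total by blast
  have one: "card {v \<in> V. E m v} \<le> 1" if "m \<in> V" for m
    using matching that finite_V by (auto simp: card_le_Suc0_iff_eq)
  have "V - M \<subseteq> {v \<in> V. E lo v} \<union> {v \<in> V. E hi v}"
    using ty lo' hi' lh E_sym by blast
  then have "card (V - M) \<le> card ({v \<in> V. E lo v} \<union> {v \<in> V. E hi v})"
    using finite_V by (intro card_mono) auto
  also have "\<dots> \<le> 2"
    using card_Un_le[of "{v \<in> V. E lo v}" "{v \<in> V. E hi v}"] one[of lo] one[of hi] lh MV by force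
  finally have "card (V - M) \<le> 2" .
  then have card3: "card M \<ge> 3"
    using card card_Diff_subset[of M V] MV finite_V finite_subset[of M V] by simp
  have c3: "card V \<ge> 3" using card by simp
  obtain v where v: "v \<in> V - M" using MV by blast
  from ty[OF v] show False
  proof
    assume *: "\<forall>m \<in> M. E v m \<longleftrightarrow> m \<sqsubset> v"
    show False
      by (rule matching_no_left[OF M c3 card3 irr _ lh(1) _ lh(2) _ v *]) (fact matching lo' hi')+
  next
    assume *: "\<forall>m \<in> M. E v m \<longleftrightarrow> v \<sqsubset> m"
    \<comment> \<open>Reversing the order exchanges \<open>lo\<close> with \<open>hi\<close> and the
      two ways in which \<open>v\<close> can be joined to \<open>M\<close>.\<close>
    have M': "nt_module V (\<lambda>x y. y \<sqsubset> x) E M" using M nt_module_dual by metis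
    have irr': "\<not> sealed V (\<lambda>x y. y \<sqsubset> x) E I" for I using irr sealed_dual by metis
    show False
      by (rule ordered_graph.matching_no_left[OF ordered_graph_dual M' c3 card3 irr' _ lh(2) _ lh(1) _ v *])
        (fact matching lo' hi')+
  qed
qed

end

section \<open>One vertex of degree two\<close>

text \<open>The hub \<open>h\<close> stands for \<open>v_hat Q\<close>, and \<open>a\<close>,
  \<open>b\<close> for \<open>v_minus Q\<close>, \<open>v_plus Q\<close>. Their order is not
  recorded, which keeps the locale closed under reversal. Vertices outside the pairs are isolated,
  so \<open>uniq\<close> asks for at most one neighbour.\<close>

locale quasi_matching = ordered_graph +
  fixes h a b
  assumes hab: "h \<in> V" "a \<in> V" "b \<in> V" "h \<noteq> a" "h \<noteq> b" "a \<noteq> b"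
    and nbr_h: "w \<in> V \<Longrightarrow> E h w \<longleftrightarrow> w = a \<or> w = b"
    and uniq: "\<lbrakk>u \<in> V; u \<noteq> h; v \<in> V; w \<in> V; E u v; E u w\<rbrakk> \<Longrightarrow> v = w"
    and card6: "card V \<ge> 6"
    and irr: "\<not> sealed V L E I"
begin

lemma quasi_matching_dual: "quasi_matching V (\<lambda>x y. y \<sqsubset> x) E h a b"
proof (intro quasi_matching.intro quasi_matching_axioms.intro)
  show "ordered_graph V (\<lambda>x y. y \<sqsubset> x) E" by (rule ordered_graph_dual)
  show "\<not> sealed V (\<lambda>x y. y \<sqsubset> x) E I" for I using irr[of I] sealed_dual[of V L E I] by blast
qed (fact hab nbr_h uniq card6)+

lemma nbr_ab: "u = h" if "u \<in> V" "x = a \<or> x = b" "E u x"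
  using uniq[of x u h] that hab nbr_h E_sym by blast

text \<open>Without \<open>x\<close> the hub keeps one neighbour, so a matching on at least five
  vertices remains. By \<open>sealed_delete\<close>, a sealed interval in it would give one in
  \<open>V\<close>.\<close>

lemma delete_no_module:
  assumes x: "x = a \<or> x = b" and g: "g \<in> V" "g \<noteq> x" "consecutive V L x g"
    and gh: "\<And>J. sealed (V - {x}) L E J \<Longrightarrow> g \<in> J \<longleftrightarrow> h \<in> J"
  shows "\<not> nt_module (V - {x}) L E M"
proof (rule ordered_graph.matching_no_module[OF ordered_graph_delete])
  show "card (V - {x}) \<ge> 5" using card6 x hab finite_V by (auto simp: card_Diff_singleton)
  show "\<not> sealed (V - {x}) L E J" for J
    using sealed_delete[of x J h g] g gh irr x hab nbr_ab by blast
  show "v = w" if "u \<in> V - {x}" "v \<in> V - {x}" "w \<in> V - {x}" "E u v" "E u w" for u v w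
    using that uniq[of u v w] nbr_h x by blast
qed

end

section \<open>No two of the hub and its two neighbours are consecutive\<close>

locale spread_quasi_matching = quasi_matching +
  assumes spread: "\<not> consecutive V L a h" "\<not> consecutive V L b h" "\<not> consecutive V L a b"
begin

lemma consecutive_sym: "consecutive V L x y \<longleftrightarrow> consecutive V L y x"
  unfolding consecutive_def by (auto simp: insert_commute)

lemma spread_quasi_matching_dual: "spread_quasi_matching V (\<lambda>x y. y \<sqsubset> x) E h a b"
  using quasi_matching_dual spread consecutive_dual
  by (simp add: spread_quasi_matching_def spread_quasi_matching_axioms_def)

text \<open>This follows \<open>matching_no_left\<close>, with the hub as the possible exception. If
  the hub is \<open>v\<close> or \<open>lo\<close>, a forbidden consecutive pair appears at the
  bottom of \<open>V\<close>; otherwise \<open>{lo, v}\<close> is sealed.\<close>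

lemma no_left:
  assumes M: "nt_module V L E M"
    and lo: "lo \<in> M" "\<And>x. x \<in> V \<Longrightarrow> x \<noteq> lo \<Longrightarrow> lo \<sqsubset> x"
    and hi: "hi \<in> M" "\<And>x. x \<in> V \<Longrightarrow> x \<noteq> hi \<Longrightarrow> x \<sqsubset> hi"
    and card3: "card M \<ge> 3" and card4: "lo \<noteq> h \<Longrightarrow> hi \<noteq> h \<Longrightarrow> card M \<ge> 4"
    and v: "v \<in> V - M" "\<forall>m \<in> M. E v m \<longleftrightarrow> m \<sqsubset> v"
  shows False
proof -
  have MV: "M \<subseteq> V" and
    ty: "\<And>v. v \<in> V - M \<Longrightarrow> (\<forall>m \<in> M. E v m \<longleftrightarrow> m \<sqsubset> v) \<or> (\<forall>m \<in> M. E v m \<longleftrightarrow> v \<sqsubset> m)"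
    using M by (auto simp: nt_module_def)
  have vlo: "E v lo" "v \<noteq> lo" using v lo MV by blast+
  have gap: "E z lo \<or> E z hi" if "z \<in> V - M" for z
    using ty[OF that] lo hi that by blast
  have not2: "\<not> M \<subseteq> {lo, hi}"
  proof
    assume "M \<subseteq> {lo, hi}"
    then have "card M \<le> card {lo, hi}" by (intro card_mono) auto
    also have "\<dots> \<le> 2" by (simp add: card_insert_if)
    finally show False using card3 by simp
  qed
  show False
  proof (cases "v = h")
    case True
    \<comment> \<open>One of \<open>a\<close>, \<open>b\<close> is \<open>lo\<close>; the other,
      \<open>q\<close>, is shown to be the second smallest vertex.\<close>
    have "\<exists>q. consecutive V L lo q \<and> (lo = a \<and> q = b \<or> lo = b \<and> q = a)"
    proof -
      obtain q where q: "lo = a \<and> q = b \<or> lo = b \<and> q = a"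
        using vlo nbr_h lo MV True by blast
      have hM: "h \<notin> M" using v True by blast
      have qV: "q \<in> V" using q hab by blast
      have qM: "q \<in> M"
      \<comment> \<open>In a gap, \<open>q\<close> would be adjacent to an end of \<open>M\<close>,
        yet its only neighbour \<open>h\<close> is outside \<open>M\<close>.\<close>
      proof (rule ccontr)
        assume "q \<notin> M"
        then have "E q lo \<or> E q hi" using gap qV by blast
        then have "lo = h \<or> hi = h" using nbr_ab q lo hi MV E_sym by (metis subsetD)
        then show False using lo hi hM by blast
      qed
      have qh: "q \<sqsubset> h" using qM v True q nbr_h qV by blast
      have "\<not> z \<sqsubset> q" if z: "z \<in> V - {lo, q}" for z
      proof
        assume zq: "z \<sqsubset> q"
        have zh: "z \<sqsubset> h" "z \<noteq> h" using zq qh trans asym by blast+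
        have zM: "z \<notin> M" using zh v True q nbr_h z by blast
        have nlo: "\<not> E z lo" using nbr_ab[of z lo] q z zh by blast
        have zr: "\<forall>m \<in> M. E z m \<longleftrightarrow> z \<sqsubset> m" using ty[of z] z zM nlo lo by blast
        then have "E z q" "E z hi" using qM zq hi z zM by blast+
        then have "q = hi" using uniq[of z q hi] zh z qV hi MV by blast
        then show False using qh hi hab hM asym by blast
      qed
      moreover have "\<not> z \<sqsubset> lo" if "z \<in> V - {lo, q}" for z using that lo asym by blast
      ultimately have "consecutive V L lo q" unfolding consecutive_def by blast
      then show ?thesis using q by blast
    qed
    then show False using spread consecutive_sym by blast
  next
    case vh: False
    have below: "m = lo" if "m \<in> M" "m \<sqsubset> v" for m
      using that v vlo uniq[of v m lo] vh lo MV by blast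
    \<comment> \<open>Such a \<open>z\<close> is adjacent to all of \<open>M\<close> above it.
      Unless \<open>z\<close> is the hub this is only \<open>hi\<close>, and \<open>M\<close>
      shrinks to \<open>{lo, hi}\<close>.\<close>
    have right: "z \<in> V - M" "\<forall>m \<in> M. E z m \<longleftrightarrow> z \<sqsubset> m" "z = h"
      if z: "z \<in> V" "z \<noteq> lo" "z \<sqsubset> v" "\<not> E z lo" for z
    proof -
      show zM: "z \<in> V - M" using z below by blast
      show zr: "\<forall>m \<in> M. E z m \<longleftrightarrow> z \<sqsubset> m" using ty[OF zM] z lo by blast
      show "z = h"
      proof (rule ccontr)
        assume "z \<noteq> h"
        have "m = lo \<or> m = hi" if m: "m \<in> M" for m
        proof (cases "z \<sqsubset> m")
          case True
          moreover have "z \<sqsubset> hi" using hi zM by blast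
          ultimately show ?thesis using zr m hi uniq[of z m hi] z MV \<open>z \<noteq> h\<close> by blast
        next
          case False
          then have "m \<sqsubset> v" using total[of z m] trans[of m z v] z(3) m zM by blast
          then show ?thesis using below m by blast
        qed
        then show False using not2 by blast
      qed
    qed
    show False
    proof (cases "lo = h")
      case True
      have vab: "v = a \<or> v = b" using vlo True nbr_h v E_sym by blast
      have zq: "z = a \<or> z = b" if "z \<in> V" "z \<noteq> h" "z \<sqsubset> v" for z
        using right(3)[of z] that True nbr_h[of z] E_sym by blast
      \<comment> \<open>Every vertex between the hub, now the least vertex, and \<open>v\<close> is
        \<open>a\<close> or \<open>b\<close>. So exactly one lies there, and it is consecutive to
        the hub.\<close>
      have "\<not> consecutive V L v h" using vab spread by blast
      then obtain z where z: "z \<in> V - {v, h}" "z \<sqsubset> v"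
        unfolding consecutive_def using lo(2) True asym by blast
      then have zab: "z = a \<or> z = b" using zq by blast
      have "\<not> w \<sqsubset> z" if w: "w \<in> V - {z, h}" for w
      proof
        assume "w \<sqsubset> z"
        then have "w \<sqsubset> v" using z trans by blast
        then have "w = a \<or> w = b" using zq w by blast
        then have "w = v" using zab vab w z by blast
        then show False using \<open>w \<sqsubset> v\<close> irrefl by blast
      qed
      then have "consecutive V L z h" unfolding consecutive_def using lo(2) True asym by blast
      then show False using zab spread by blast
    next
      case False
      \<comment> \<open>Only the hub could lie between \<open>lo\<close> and \<open>v\<close>. It
        would be adjacent to all of \<open>M\<close> above it, so \<open>M\<close> would lie in
        \<open>{lo, a, b}\<close>; this is where \<open>card4\<close> enters.\<close>
      have above: "v \<sqsubset> z" if z: "z \<in> V" "z \<noteq> lo" "z \<noteq> v" for z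
      proof (rule ccontr)
        assume "\<not> v \<sqsubset> z"
        then have zv: "z \<sqsubset> v" using total z by blast
        have "\<not> E z lo" using uniq[of lo z v] vlo E_sym z v False lo MV by blast
        note r = right[OF z(1,2) zv this]
        have "m = lo \<or> m = a \<or> m = b" if m: "m \<in> M" for m
        proof (cases "z \<sqsubset> m")
          case True
          then show ?thesis using r m nbr_h MV by blast
        next
          case False
          then have "m \<sqsubset> v" using total[of z m] trans[of m z v] zv m r(1) by blast
          then show ?thesis using below m by blast
        qed
        then have "card M \<le> card {lo, a, b}" by (intro card_mono) auto
        also have "\<dots> \<le> 3" by (simp add: card_insert_if)
        finally show False using card4 False r hi by fastforce
      qed
      have "sealed V L E {lo, v}"
        unfolding sealed_def
      proof (intro conjI ballI)
        show "{lo, v} \<subseteq> V" using lo v MV by blast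
        have "card {lo, v} = 2" using vlo by simp
        then show "{lo, v} \<noteq> V" "\<not> is_singleton {lo, v}"
          using card6 by (auto simp: is_singleton_altdef)
        show "(\<forall>i \<in> {lo, v}. i \<sqsubset> x) \<or> (\<forall>i \<in> {lo, v}. x \<sqsubset> i)" if "x \<in> V - {lo, v}" for x
          using that above lo by blast
        show "\<not> E u w" if "u \<in> {lo, v}" "w \<in> V - {lo, v}" for u w
          using that vlo uniq[of u w] E_sym lo v MV vh False by blast
      qed simp
      then show False using irr by blast
    qed
  qed
qed

text \<open>The neighbours of the hub are \<open>lo\<close> and \<open>y\<close>, so
  \<open>lo\<close> is the vertex to delete. Exactly one vertex \<open>g\<close> lies between
  \<open>lo\<close> and the hub, and it is matched to \<open>hi\<close>. The edges from
  \<open>g\<close> to \<open>hi\<close> and from \<open>h\<close> to \<open>y\<close> interlace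
  enough to keep \<open>g\<close> and \<open>h\<close> together in every sealed interval.\<close>

lemma left_hub:
  assumes M: "nt_module V L E M"
    and lo: "lo \<in> M" "\<And>x. x \<in> M \<Longrightarrow> x \<noteq> lo \<Longrightarrow> lo \<sqsubset> x"
    and hi: "hi \<in> M" "\<And>x. x \<in> M \<Longrightarrow> x \<noteq> hi \<Longrightarrow> x \<sqsubset> hi"
    and h: "h \<notin> M" "lo \<sqsubset> h" "h \<sqsubset> hi" "\<forall>m \<in> M. E h m \<longleftrightarrow> m \<sqsubset> h"
    and y: "y \<in> V" "E h y" "y \<sqsubset> lo \<or> hi \<sqsubset> y"
  shows "\<exists>x g. (x = a \<or> x = b) \<and> g \<in> V \<and> g \<noteq> x \<and> consecutive V L x g \<and>
    (\<forall>J. sealed (V - {x}) L E J \<longrightarrow> (g \<in> J \<longleftrightarrow> h \<in> J))"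
proof -
  have MV: "M \<subseteq> V" and
    ty: "\<And>v. v \<in> V - M \<Longrightarrow> (\<forall>m \<in> M. E v m \<longleftrightarrow> m \<sqsubset> v) \<or> (\<forall>m \<in> M. E v m \<longleftrightarrow> v \<sqsubset> m)"
    using M by (auto simp: nt_module_def)
  have yM: "y \<notin> M" using y lo hi asym by blast
  have loab: "lo = a \<or> lo = b" using h lo nbr_h MV by blast
  have yab: "y = a \<or> y = b" using y nbr_h by blast
  have below: "m = lo" if "m \<in> M" "m \<sqsubset> h" for m
    using that h nbr_h[of m] loab yab yM MV lo by blast
  have between: "E z hi \<and> z \<notin> M \<and> z \<noteq> h" if z: "z \<in> V" "lo \<sqsubset> z" "z \<sqsubset> h" for z
  proof -
    have zM: "z \<notin> M" "z \<noteq> h" using below z irrefl by blast+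
    moreover have "\<not> E z lo" using nbr_ab[of z lo] loab z zM by blast
    moreover have "z \<sqsubset> hi" using z h trans by blast
    ultimately show ?thesis using ty[of z] z lo hi by blast
  qed
  have "\<not> consecutive V L lo h" using loab spread by blast
  then obtain g where g: "g \<in> V" "lo \<sqsubset> g" "g \<sqsubset> h"
    unfolding consecutive_def using total trans h(2) asym by (metis Diff_iff insert_iff)
  have ghi: "E g hi" "g \<notin> M" "g \<noteq> h" using between[OF g] by blast+
  \<comment> \<open>Every vertex between \<open>lo\<close> and \<open>h\<close> is adjacent to
    \<open>hi\<close>, which has only one neighbour.\<close>
  have "consecutive V L lo g"
    unfolding consecutive_def
  proof (intro ballI iffI)
    fix z assume z: "z \<in> V - {lo, g}"
    show "z \<sqsubset> g" if "z \<sqsubset> lo" using that g trans by blast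
    show "z \<sqsubset> lo" if zg: "z \<sqsubset> g"
    proof (rule ccontr)
      assume "\<not> z \<sqsubset> lo"
      then have "lo \<sqsubset> z" "z \<sqsubset> h" using total z zg g trans by blast+
      then have "E z hi" using between z by blast
      then show False using uniq[of hi z g] ghi hi h z g MV E_sym by blast
    qed
  qed
  moreover have "g \<in> J \<longleftrightarrow> h \<in> J" if J: "sealed (V - {lo}) L E J" for J
  proof -
    \<comment> \<open>A sealed set is convex (\<open>int\<close>) and closed under adjacency
      (\<open>clo\<close>), away from the deleted vertex.\<close>
    have int: "z \<in> J" if "p \<in> J" "q \<in> J" "p \<sqsubset> z" "z \<sqsubset> q" "z \<in> V" "z \<noteq> lo" for p q z
      using J that asym unfolding sealed_def by blast
    have clo: "w \<in> J" if "E u w" "u \<in> J" "w \<in> V" "w \<noteq> lo" for u w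
      using J that unfolding sealed_def by blast
    have ne: "lo \<noteq> hi" "h \<noteq> lo" "g \<noteq> lo" "y \<noteq> lo"
      using h trans irrefl g yM lo by blast+
    have hiV: "hi \<in> V" using hi MV by blast
    have ghJ: "g \<in> J \<longleftrightarrow> hi \<in> J" using clo[of g hi] clo[of hi g] ghi E_sym hiV g ne by blast
    show ?thesis
    proof
      assume "g \<in> J"
      then show "h \<in> J" using ghJ int[of g hi h] g h hab ne by blast
    next
      assume hJ: "h \<in> J"
      then have yJ: "y \<in> J" using clo[of h y] y ne by blast
      from y(3) show "g \<in> J"
      proof
        assume "y \<sqsubset> lo"
        then show ?thesis using int[of y h g] yJ hJ g ne trans by blast
      next
        assume "hi \<sqsubset> y"
        then show ?thesis using int[of h y hi] yJ hJ h ne hiV ghJ by blast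
      qed
    qed
  qed
  ultimately show ?thesis using loab g ghi lo by blast
qed

text \<open>A module reaching both ends of \<open>V\<close> is excluded by counting and
  \<open>no_left\<close>. Otherwise an edge leaves its hull; it must start at the hub, located in a
  gap of \<open>M\<close>, and \<open>left_hub\<close> or its mirror image applies.\<close>

lemma ex_deletable:
  assumes M: "nt_module V L E M"
  shows "\<exists>x g. (x = a \<or> x = b) \<and> g \<in> V \<and> g \<noteq> x \<and> consecutive V L x g \<and>
    (\<forall>J. sealed (V - {x}) L E J \<longrightarrow> (g \<in> J \<longleftrightarrow> h \<in> J))"
proof -
  have MV: "M \<subseteq> V" "M \<noteq> V" and
    ty: "\<And>v. v \<in> V - M \<Longrightarrow> (\<forall>m \<in> M. E v m \<longleftrightarrow> m \<sqsubset> v) \<or> (\<forall>m \<in> M. E v m \<longleftrightarrow> v \<sqsubset> m)"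
    using M by (auto simp: nt_module_def)
  obtain lo hi where lh: "lo \<in> M" "hi \<in> M" "lo \<sqsubset> hi"
    and lo: "\<And>x. x \<in> M \<Longrightarrow> x \<noteq> lo \<Longrightarrow> lo \<sqsubset> x" and hi: "\<And>x. x \<in> M \<Longrightarrow> x \<noteq> hi \<Longrightarrow> x \<sqsubset> hi"
    using module_extremes[OF M] by metis
  have lhV: "lo \<in> V" "hi \<in> V" "lo \<noteq> hi" using lh MV irrefl by blast+
  interpret dual: spread_quasi_matching V "\<lambda>x y. y \<sqsubset> x" E h a b
    by (rule spread_quasi_matching_dual)
  have M': "nt_module V (\<lambda>x y. y \<sqsubset> x) E M" using M nt_module_dual by metis
  show ?thesis
  proof (cases "\<exists>z \<in> V. z \<sqsubset> lo \<or> hi \<sqsubset> z")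
    case True
    then obtain z where z: "z \<in> V" "z \<sqsubset> lo \<or> hi \<sqsubset> z" by blast
    obtain u w where uw: "u \<in> V" "w \<in> V" "\<not> u \<sqsubset> lo" "\<not> hi \<sqsubset> u" "w \<sqsubset> lo \<or> hi \<sqsubset> w" "E u w"
      using sealed_hull[OF lhV(1,2) lh(3) z] irr by blast
    have wM: "w \<notin> M" using uw(5) lo hi asym by blast
    \<comment> \<open>If \<open>u\<close> were in \<open>M\<close>, then \<open>w\<close> would be
      adjacent to all of \<open>M\<close>, hence be the hub, and \<open>M\<close> would be
      \<open>{a, b}\<close>. A vertex between these would be adjacent to one of them, hence be the
      hub, which lies outside the hull.\<close>
    have uM: "u \<notin> M"
    proof
      assume uM: "u \<in> M"
      have all: "E w m" if "m \<in> M" for m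
        using ty[of w] wM uw E_sym[OF uw(6)] that uM lo hi asym trans by (metis DiffI)
      then have wh: "w = h" using uniq[of w lo hi] lh lhV uw by blast
      then have Mab: "m = a \<or> m = b" if "m \<in> M" for m using all that nbr_h MV by blast
      have "consecutive V L lo hi"
        unfolding consecutive_def
      proof (intro ballI iffI)
        fix x assume x: "x \<in> V - {lo, hi}"
        show "x \<sqsubset> hi" if "x \<sqsubset> lo" using that lh trans by blast
        show "x \<sqsubset> lo" if "x \<sqsubset> hi"
        proof (rule ccontr)
          assume "\<not> x \<sqsubset> lo"
          then have lx: "lo \<sqsubset> x" using total x by blast
          have "x \<notin> M" using Mab[of x] Mab[of lo] Mab[of hi] lh lhV x by blast
          then have "E x lo \<or> E x hi" using ty[of x] x lx that lh by blast
          then have "x = h" using nbr_ab[of x] Mab lh x by blast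
          then show False using wh uw(5) lx that asym by blast
        qed
      qed
      then show False
        using spread(3) consecutive_sym Mab[of lo] Mab[of hi] lh lhV by metis
    qed
    have ulh: "lo \<sqsubset> u" "u \<sqsubset> hi" using uw total[of u lo] total[of u hi] uM lh by auto
    have "E u lo \<or> E u hi" using ty[of u] uM uw ulh lh by blast
    then have uh: "u = h" using uniq[of u w] uw wM lh MV by blast
    have "(\<forall>m \<in> M. E h m \<longleftrightarrow> m \<sqsubset> h) \<or> (\<forall>m \<in> M. E h m \<longleftrightarrow> h \<sqsubset> m)"
      using ty[of u] uM uw uh by blast
    then show ?thesis
    proof
      assume "\<forall>m \<in> M. E h m \<longleftrightarrow> m \<sqsubset> h"
      then show ?thesis
        using left_hub[OF M lh(1) lo lh(2) hi] uM uh ulh uw by blast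
    next
      assume "\<forall>m \<in> M. E h m \<longleftrightarrow> h \<sqsubset> m"
      then show ?thesis
        using dual.left_hub[OF M' lh(2) hi lh(1) lo, of w] uM uh ulh uw
        unfolding consecutive_dual sealed_dual[of _ L] by blast
    qed
  next
    case False
    then have lo': "lo \<sqsubset> x" if "x \<in> V" "x \<noteq> lo" for x using that total by blast
    have hi': "x \<sqsubset> hi" if "x \<in> V" "x \<noteq> hi" for x using False that total by blast
    have fin: "finite {v \<in> V. E m v}" for m using finite_V by simp
    have one: "card {v \<in> V. E m v} \<le> 1" if "m \<in> V" "m \<noteq> h" for m
      using uniq[OF that] finite_V by (auto simp: card_le_Suc0_iff_eq)
    have "{v \<in> V. E h v} = {a, b}" using nbr_h hab by blast
    then have two: "card {v \<in> V. E h v} = 2" using hab by simp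
    have "V - M \<subseteq> {v \<in> V. E lo v} \<union> {v \<in> V. E hi v}"
      using ty lo' hi' lh E_sym by blast
    then have "card (V - M) \<le> card ({v \<in> V. E lo v} \<union> {v \<in> V. E hi v})"
      using fin by (intro card_mono) auto
    also have "\<dots> \<le> card {v \<in> V. E lo v} + card {v \<in> V. E hi v}" by (rule card_Un_le)
    finally have le: "card (V - M) \<le> card {v \<in> V. E lo v} + card {v \<in> V. E hi v}" .
    have cM: "card V = card M + card (V - M)"
      using card_Diff_subset[of M V] MV finite_V finite_subset[of M V] card_mono[of V M] by simp
    \<comment> \<open>The ends of \<open>M\<close> have degree sum at most 2, or 3 if one of them is
      the hub. This bounds \<open>card (V - M)\<close>, and six vertices leave at least 4,
      respectively 3, in \<open>M\<close>.\<close>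
    have c4: "card M \<ge> 4" if "lo \<noteq> h" "hi \<noteq> h"
      using le cM one[of lo] one[of hi] that lhV card6 by linarith
    have c3: "card M \<ge> 3"
    proof (cases "lo = h \<or> hi = h")
      case True
      then show ?thesis using le cM one[of lo] one[of hi] two lhV card6 by auto
    next
      case False
      then show ?thesis using c4 by simp
    qed
    obtain v where v: "v \<in> V - M" using MV by blast
    from ty[OF v] have False
    proof
      assume *: "\<forall>m \<in> M. E v m \<longleftrightarrow> m \<sqsubset> v"
      show False by (rule no_left[OF M lh(1) _ lh(2) _ c3 _ v *]) (use c4 in \<open>simp_all add: lo' hi'\<close>)
    next
      assume *: "\<forall>m \<in> M. E v m \<longleftrightarrow> v \<sqsubset> m"
      show False by (rule dual.no_left[OF M' lh(2) _ lh(1) _ c3 _ v *]) (use c4 in \<open>auto simp: lo' hi'\<close>)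
    qed
    then show ?thesis ..
  qed
qed

end

context quasi_matching
begin

lemma no_module_or_deletable:
  "(\<forall>M. \<not> nt_module V L E M) \<or> (\<forall>M. \<not> nt_module (V - {a}) L E M) \<or>
   (\<forall>M. \<not> nt_module (V - {b}) L E M)"
proof (cases "consecutive V L a h \<or> consecutive V L b h \<or> consecutive V L a b")
  case True
  \<comment> \<open>For consecutive \<open>a\<close>, \<open>b\<close> the choice is
    \<open>x = a\<close>, \<open>g = b\<close>: the edge from \<open>b\<close> to the hub survives.
    For a vertex consecutive to the hub, \<open>g\<close> is the hub itself.\<close>
  have "b \<in> J \<longleftrightarrow> h \<in> J" if "sealed (V - {a}) L E J" for J
    using that hab nbr_h E_sym[of h b] unfolding sealed_def by blast
  with True show ?thesis
    using delete_no_module[of a h] delete_no_module[of b h] delete_no_module[of a b] hab by blast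
next
  case False
  then interpret spread_quasi_matching V L E h a b by unfold_locales auto
  show ?thesis using ex_deletable delete_no_module by blast
qed

end

section \<open>Inverted tournaments and quasi-pairings\<close>

text \<open>Only the arc rule on \<open>X\<close> is assumed, so that the lemma covers both the
  inverted tournament and its vertex deletions.\<close>

lemma nontrivial_module_iff_nt_module:
  fixes G :: "('a::linorder, 'b) pre_digraph"
  assumes verts: "verts G = X"
    and arcs: "\<And>u v. \<lbrakk>u \<in> X; v \<in> X; u \<noteq> v\<rbrakk> \<Longrightarrow> u \<rightarrow>\<^bsub>G\<^esub> v \<longleftrightarrow> (u < v \<longleftrightarrow> {u, v} \<notin> Q)"
  shows "nontrivial_module G M \<longleftrightarrow> nt_module X (<) (\<lambda>u v. {u, v} \<in> Q) M"
proof (cases "M \<subseteq> X")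
  case True
  have "v \<rightarrow>\<^bsub>G\<^esub> m \<longleftrightarrow> ({v, m} \<in> Q \<longleftrightarrow> m < v)" "m \<rightarrow>\<^bsub>G\<^esub> v \<longleftrightarrow> ({v, m} \<in> Q \<longleftrightarrow> v < m)"
    if "v \<in> X - M" "m \<in> M" for v m
  proof -
    have vm: "v \<in> X" "m \<in> X" "v \<noteq> m" using that True by auto
    then show "v \<rightarrow>\<^bsub>G\<^esub> m \<longleftrightarrow> ({v, m} \<in> Q \<longleftrightarrow> m < v)" "m \<rightarrow>\<^bsub>G\<^esub> v \<longleftrightarrow> ({v, m} \<in> Q \<longleftrightarrow> v < m)"
      using arcs[of v m] arcs[of m v] by (auto simp: insert_commute)
  qed
  then show ?thesis
    unfolding nontrivial_module_def is_module_def nt_module_def verts by auto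
next
  case False
  then show ?thesis
    unfolding nontrivial_module_def is_module_def nt_module_def verts by auto
qed

lemma dominates_Inv:
  "u \<rightarrow>\<^bsub>with_proj (Inv (transitive_tournament V) Q)\<^esub> v \<longleftrightarrow>
    u \<in> V \<and> v \<in> V \<and> u \<noteq> v \<and> (u < v \<longleftrightarrow> {u, v} \<notin> Q)"
  unfolding with_proj_simps
  by (cases u v rule: linorder_cases)
    (auto simp: Inv_def transitive_tournament_def insert_commute)

lemma verts_Inv: "verts (with_proj (Inv (transitive_tournament V) Q)) = V"
  by (simp add: Inv_def transitive_tournament_def)

lemma nontrivial_module_Inv:
  "nontrivial_module (with_proj (Inv (transitive_tournament V) Q)) M \<longleftrightarrow>
    nt_module V (<) (\<lambda>u v. {u, v} \<in> Q) M"
  by (rule nontrivial_module_iff_nt_module, rule verts_Inv, unfold dominates_Inv) blast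

lemma dominates_delete_vertex:
  "u \<rightarrow>\<^bsub>delete_vertex (with_proj G) x\<^esub> v \<longleftrightarrow>
    u \<in> pverts G - {x} \<and> v \<in> pverts G - {x} \<and> u \<rightarrow>\<^bsub>with_proj G\<^esub> v"
  by (auto simp: delete_vertex_def induce_subgraph_def arcs_ends_def arc_to_ends_def)

lemma nontrivial_module_delete_Inv:
  "nontrivial_module (delete_vertex (with_proj (Inv (transitive_tournament V) Q)) x) M \<longleftrightarrow>
    nt_module (V - {x}) (<) (\<lambda>u v. {u, v} \<in> Q) M"
proof (rule nontrivial_module_iff_nt_module)
  have V: "pverts (Inv (transitive_tournament V) Q) = V"
    using verts_Inv[of V Q] by simp
  then show "verts (delete_vertex (with_proj (Inv (transitive_tournament V) Q)) x) = V - {x}"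
    by (simp add: delete_vertex_def)
  show "u \<rightarrow>\<^bsub>delete_vertex (with_proj (Inv (transitive_tournament V) Q)) x\<^esub> v \<longleftrightarrow> (u < v \<longleftrightarrow> {u, v} \<notin> Q)"
    if "u \<in> V - {x}" "v \<in> V - {x}" "u \<noteq> v" for u v
    using that unfolding dominates_delete_vertex V dominates_Inv by blast
qed

lemma nontrivial_module_transitive_tournament:
  "nontrivial_module (with_proj (transitive_tournament V)) M \<longleftrightarrow> nontrivial_interval_of V M"
proof -
  have "u \<rightarrow>\<^bsub>with_proj (transitive_tournament V)\<^esub> v \<longleftrightarrow> u \<in> V \<and> v \<in> V \<and> u < v" for u v
    unfolding with_proj_simps by (auto simp: transitive_tournament_def)
  moreover have "verts (with_proj (transitive_tournament V)) = V"
    by (simp add: transitive_tournament_def)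
  ultimately show ?thesis
    unfolding nontrivial_module_def is_module_def nontrivial_interval_of_def interval_of_def by auto
qed

lemma sealed_less_iff:
  "sealed V (<) E I \<longleftrightarrow> nontrivial_interval_of V I \<and> (\<forall>u \<in> I. \<forall>w \<in> V - I. \<not> E u w)"
  unfolding sealed_def nontrivial_interval_of_def interval_of_def by auto

section \<open>Transversals of minimal co-modules\<close>

lemma ex_minimal_co_module:
  assumes "finite (verts G)" "co_module G M"
  shows "\<exists>F \<in> mc G. F \<subseteq> M"
proof -
  have "finite M" using assms by (meson co_module_def finite_subset)
  then show ?thesis
    using assms(2)
  proof (induction M rule: finite_psubset_induct)
    case (psubset A)
    show ?case
    proof (cases "A \<in> mc G")
      case False
      then obtain N where N: "co_module G N" "N \<subset> A"
        using psubset.prems by (auto simp: mc_def)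
      obtain F where "F \<in> mc G" "F \<subseteq> N" using psubset.IH[OF N(2,1)] by blast
      then show ?thesis using N(2) by (meson psubset_imp_subset subset_trans)
    qed blast
  qed
qed

lemma transversal_mc_iff:
  assumes "finite (verts G)"
  shows "transversal (mc G) R \<longleftrightarrow> (\<forall>M. co_module G M \<longrightarrow> R \<inter> M \<noteq> {})"
proof
  assume "transversal (mc G) R"
  then have meets: "R \<inter> F \<noteq> {}" if "F \<in> mc G" for F
    using that by (simp add: transversal_def)
  show "\<forall>M. co_module G M \<longrightarrow> R \<inter> M \<noteq> {}"
  proof (intro allI impI)
    fix M assume "co_module G M"
    then obtain F where "F \<in> mc G" "F \<subseteq> M" using ex_minimal_co_module[OF assms] by blast
    then show "R \<inter> M \<noteq> {}" using meets by blast
  qed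
qed (simp add: transversal_def mc_def)

text \<open>Each co-module contains a minimal one, so all co-modules have to be met. For a
  transitive tournament these are the nontrivial intervals and their complements.\<close>

lemma transversal_mc_transitive_tournament_iff:
  assumes "finite V" "W \<subseteq> V"
  shows "transversal (mc (with_proj (transitive_tournament V))) W \<longleftrightarrow>
    (\<forall>I. nontrivial_interval_of V I \<longrightarrow> W \<inter> I \<noteq> {} \<and> \<not> W \<subseteq> I)"
proof -
  let ?G = "with_proj (transitive_tournament V)"
  have verts: "verts ?G = V" by (simp add: transitive_tournament_def)
  have sub: "I \<subseteq> V" if "nontrivial_interval_of V I" for I
    using that by (auto simp: nontrivial_interval_of_def interval_of_def)
  have co: "co_module ?G M \<longleftrightarrow> M \<subseteq> V \<and> (nontrivial_interval_of V M \<or> nontrivial_interval_of V (V - M))" for M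
    unfolding co_module_def verts nontrivial_module_transitive_tournament ..
  have comp: "co_module ?G I" "co_module ?G (V - I)" if "nontrivial_interval_of V I" for I
    using that sub[OF that] by (auto simp: co double_diff)
  have "transversal (mc ?G) W \<longleftrightarrow> (\<forall>M. co_module ?G M \<longrightarrow> W \<inter> M \<noteq> {})"
    using transversal_mc_iff[of ?G W] assms(1) verts by simp
  also have "\<dots> \<longleftrightarrow> (\<forall>I. nontrivial_interval_of V I \<longrightarrow> W \<inter> I \<noteq> {} \<and> W \<inter> (V - I) \<noteq> {})"
  proof (intro iffI allI impI)
    fix I assume "\<forall>M. co_module ?G M \<longrightarrow> W \<inter> M \<noteq> {}" "nontrivial_interval_of V I"
    then show "W \<inter> I \<noteq> {} \<and> W \<inter> (V - I) \<noteq> {}" using comp by blast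
  next
    fix M assume *: "\<forall>I. nontrivial_interval_of V I \<longrightarrow> W \<inter> I \<noteq> {} \<and> W \<inter> (V - I) \<noteq> {}"
      and "co_module ?G M"
    then have "M \<subseteq> V" "nontrivial_interval_of V M \<or> nontrivial_interval_of V (V - M)"
      by (auto simp: co)
    then show "W \<inter> M \<noteq> {}" using * by (metis double_diff order_refl)
  qed
  also have "\<dots> \<longleftrightarrow> (\<forall>I. nontrivial_interval_of V I \<longrightarrow> W \<inter> I \<noteq> {} \<and> \<not> W \<subseteq> I)"
    using assms(2) by blast
  finally show ?thesis .
qed

section \<open>Edges and blocks of a quasi-pairing\<close>

lemma quasi_pairing_edge:
  assumes "quasi_pairing W Q" "p \<in> Q" "u \<in> p"
  shows "\<exists>w \<in> W. w \<noteq> u \<and> p = {u, w} \<and> u \<in> W"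
proof -
  have "card p = 2" "p \<subseteq> W" using assms by (auto simp: quasi_pairing_def nsets_def)
  then show ?thesis using assms(3) by (auto simp: card_2_iff)
qed

lemma quasi_pairing_partner:
  assumes "quasi_pairing W Q" "u \<in> W"
  shows "\<exists>w \<in> W. w \<noteq> u \<and> {u, w} \<in> Q"
proof -
  obtain p where "p \<in> Q" "u \<in> p" using assms by (auto simp: quasi_pairing_def)
  then show ?thesis using quasi_pairing_edge[OF assms(1)] by metis
qed

lemma quasi_pairing_verts:
  assumes "quasi_pairing W Q" "{u, w} \<in> Q"
  shows "u \<in> W" "w \<in> W" "u \<noteq> w"
  using quasi_pairing_edge[OF assms, of u] quasi_pairing_edge[OF assms, of w]
  by (auto simp: doubleton_eq_iff)

lemma quasi_pairing_hat_iff: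
  assumes "quasi_pairing W Q"
  shows "{v_hat Q, w} \<in> Q \<longleftrightarrow> w = v_minus Q \<or> w = v_plus Q"
proof -
  note q = quasi_pairing_v_minus_plus[OF assms]
  have "{v_hat Q, w} \<in> Q \<longleftrightarrow> {v_hat Q, w} \<in> {p \<in> Q. v_hat Q \<in> p}" by simp
  also have "\<dots> \<longleftrightarrow> w = v_minus Q \<or> w = v_plus Q"
    unfolding q(2) using q(3,4) by (auto simp: doubleton_eq_iff)
  finally show ?thesis .
qed

lemma quasi_pairing_unique:
  assumes "quasi_pairing W Q" "u \<noteq> v_hat Q" "{u, v} \<in> Q" "{u, w} \<in> Q"
  shows "v = w"
proof -
  have "card {p \<in> Q. u \<in> p} = 1"
    using quasi_pairing_v_hat(3)[OF assms(1) quasi_pairing_verts(1)[OF assms(1,3)] assms(2)] .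
  then obtain p where p: "{p \<in> Q. u \<in> p} = {p}" by (auto simp: card_1_singleton_iff)
  have "{u, v} \<in> {p \<in> Q. u \<in> p}" "{u, w} \<in> {p \<in> Q. u \<in> p}" using assms(3,4) by simp_all
  then have "{u, v} = {u, w}" unfolding p by simp
  then show ?thesis by (auto simp: doubleton_eq_iff)
qed

lemma quasi_pairing_block_verts:
  assumes "quasi_pairing W Q"
  shows "v_hat Q \<in> W" "v_minus Q \<in> W" "v_plus Q \<in> W"
    "v_hat Q \<noteq> v_minus Q" "v_hat Q \<noteq> v_plus Q" "v_minus Q \<noteq> v_plus Q"
proof -
  have "{v_hat Q, v_minus Q} \<in> Q" "{v_hat Q, v_plus Q} \<in> Q"
    by (simp_all add: quasi_pairing_hat_iff[OF assms])
  from this[THEN quasi_pairing_verts(2)[OF assms]] show "v_minus Q \<in> W" "v_plus Q \<in> W" .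
qed (use quasi_pairing_v_hat(1)[OF assms] quasi_pairing_v_minus_plus[OF assms] in auto)

lemma quasi_pairing_partner_minus_plus:
  assumes "quasi_pairing W Q" "x = v_minus Q \<or> x = v_plus Q"
  shows "{x, w} \<in> Q \<longleftrightarrow> w = v_hat Q"
  using quasi_pairing_hat_iff[OF assms(1), of x] quasi_pairing_unique[OF assms(1), of x w "v_hat Q"]
    quasi_pairing_block_verts[OF assms(1)] assms(2) by (auto simp: insert_commute)

lemma Q_part_eq:
  assumes "quasi_pairing W Q"
  shows "Q_part Q = insert (B_block Q) {p \<in> Q. v_hat Q \<notin> p}"
  using quasi_pairing_v_minus_plus(2)[OF assms] unfolding Q_part_def by blast

text \<open>The blocks are the connected components of the graph on \<open>W\<close>: the path
  through the hub and the remaining single edges. Unions of components are the sets closed under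
  adjacency.\<close>

lemma union_of_blocks_iff:
  assumes q: "quasi_pairing W Q" and "J \<subseteq> W"
  shows "(\<exists>\<B> \<subseteq> Q_part Q. J = \<Union>\<B>) \<longleftrightarrow> (\<forall>u w. u \<in> J \<longrightarrow> {u, w} \<in> Q \<longrightarrow> w \<in> J)"
proof
  assume "\<exists>\<B> \<subseteq> Q_part Q. J = \<Union>\<B>"
  then obtain \<B> where B: "\<B> \<subseteq> Q_part Q" "J = \<Union>\<B>" by blast
  show "\<forall>u w. u \<in> J \<longrightarrow> {u, w} \<in> Q \<longrightarrow> w \<in> J"
  proof (intro allI impI)
    fix u w assume "u \<in> J" and uw: "{u, w} \<in> Q"
    then obtain p where p: "p \<in> \<B>" "u \<in> p" using B by blast
    have "w \<in> p"
    proof (cases "p = B_block Q")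
      case True
      then show ?thesis
        using p(2) uw quasi_pairing_hat_iff[OF q] quasi_pairing_partner_minus_plus[OF q]
        unfolding B_block_def by blast
    next
      case False
      then have pQ: "p \<in> Q" "v_hat Q \<notin> p" using p B Q_part_eq[OF q] by auto
      then obtain v where "p = {u, v}" using quasi_pairing_edge[OF q _ p(2)] by blast
      then show ?thesis using quasi_pairing_unique[OF q, of u v w] uw pQ by blast
    qed
    then show "w \<in> J" using p B by blast
  qed
next
  assume closed: "\<forall>u w. u \<in> J \<longrightarrow> {u, w} \<in> Q \<longrightarrow> w \<in> J"
  have "\<exists>p \<in> Q_part Q. u \<in> p \<and> p \<subseteq> J" if u: "u \<in> J" for u
  proof (cases "u \<in> B_block Q")
    case True
    then have "v_hat Q \<in> J"
      using u closed quasi_pairing_partner_minus_plus[OF q] unfolding B_block_def by blast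
    then have "B_block Q \<subseteq> J"
      using closed quasi_pairing_hat_iff[OF q] unfolding B_block_def by blast
    then show ?thesis using True Q_part_eq[OF q] by blast
  next
    case False
    obtain w where w: "{u, w} \<in> Q" using quasi_pairing_partner[OF q] u assms(2) by blast
    have "v_hat Q \<noteq> w"
      using False w quasi_pairing_hat_iff[OF q, of u] unfolding B_block_def by (auto simp: insert_commute)
    then have "{u, w} \<in> Q_part Q" using w False Q_part_eq[OF q] unfolding B_block_def by auto
    moreover have "{u, w} \<subseteq> J" using closed u w by simp
    ultimately show ?thesis by blast
  qed
  then have "J \<subseteq> \<Union>{p \<in> Q_part Q. p \<subseteq> J}" by blast
  then have "J = \<Union>{p \<in> Q_part Q. p \<subseteq> J}" by (intro equalityI) auto
  then show "\<exists>\<B> \<subseteq> Q_part Q. J = \<Union>\<B>" by (intro exI[of _ "{p \<in> Q_part Q. p \<subseteq> J}"]) simp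
qed

lemma partition_on_Q_part:
  assumes q: "quasi_pairing W Q"
  shows "partition_on W (Q_part Q)"
proof (rule partition_onI)
  \<comment> \<open>\<open>W\<close> is closed under adjacency, so that the blocks cover it.\<close>
  have "\<exists>\<B> \<subseteq> Q_part Q. W = \<Union>\<B>"
    unfolding union_of_blocks_iff[OF q order_refl] using quasi_pairing_verts(2)[OF q] by simp
  moreover have "B_block Q \<subseteq> W" using quasi_pairing_block_verts[OF q] by (simp add: B_block_def)
  moreover have "\<Union>{p \<in> Q. v_hat Q \<notin> p} \<subseteq> W" using q by (auto simp: quasi_pairing_def)
  ultimately show "\<Union>(Q_part Q) = W" unfolding Q_part_eq[OF q] by blast
  show "{} \<notin> Q_part Q"
    using quasi_pairing_edge[OF q] q unfolding Q_part_eq[OF q]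
    by (auto simp: B_block_def quasi_pairing_def nsets_def)
  have B: "p \<inter> B_block Q = {}" if p: "p \<in> Q" "v_hat Q \<notin> p" for p
  proof -
    have "x \<notin> p" if x: "x = v_minus Q \<or> x = v_plus Q" for x
    proof
      assume "x \<in> p"
      then obtain w where "p = {x, w}" using quasi_pairing_edge[OF q p(1)] by blast
      then show False using p quasi_pairing_partner_minus_plus[OF q x] by auto
    qed
    then show ?thesis using p by (auto simp: B_block_def)
  qed
  have "p = p'" if p: "p \<in> Q" "v_hat Q \<notin> p" and p': "p' \<in> Q" and u: "u \<in> p" "u \<in> p'" for p p' u
  proof -
    obtain v w where "p = {u, v}" "p' = {u, w}"
      using quasi_pairing_edge[OF q p(1) u(1)] quasi_pairing_edge[OF q p' u(2)] by blast
    then show ?thesis using quasi_pairing_unique[OF q, of u v w] p p' by auto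
  qed
  with B show "disjnt p p'" if "p \<in> Q_part Q" "p' \<in> Q_part Q" "p \<noteq> p'" for p p'
    using that unfolding Q_part_eq[OF q] disjnt_def by blast
qed

text \<open>The trace on \<open>W\<close> of a sealed interval is a union of blocks, nontrivial
  because of the transversal. Conversely, the convex hull in \<open>V\<close> of an interval of
  \<open>W\<close> that is a union of blocks is sealed; and an edge leaving an interval of
  \<open>V\<close> puts elements of \<open>W\<close> on both sides of it.\<close>

lemma transversal_irreducible_iff_not_sealed:
  assumes fin: "finite V" and WV: "W \<subseteq> V" and q: "quasi_pairing W Q"
  shows "transversal (mc (with_proj (transitive_tournament V))) W \<and> irreducible_quasi_pairing W Q \<longleftrightarrow>
    (\<nexists>I. sealed V (<) (\<lambda>u v. {u, v} \<in> Q) I)" (is "?A \<longleftrightarrow> ?B")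
proof
  assume ?A
  then have tr: "\<And>I. nontrivial_interval_of V I \<Longrightarrow> W \<inter> I \<noteq> {} \<and> \<not> W \<subseteq> I"
    and irr: "\<And>J. nontrivial_interval_of W J \<Longrightarrow> \<not> (\<exists>\<B> \<subseteq> Q_part Q. J = \<Union>\<B>)"
    using transversal_mc_transitive_tournament_iff[OF fin WV]
    by (auto simp: irreducible_quasi_pairing_def irreducible_partition_def)
  show ?B
  proof
    assume "\<exists>I. sealed V (<) (\<lambda>u v. {u, v} \<in> Q) I"
    then obtain I where I: "nontrivial_interval_of V I" "\<And>u w. u \<in> I \<Longrightarrow> w \<in> V - I \<Longrightarrow> {u, w} \<notin> Q"
      by (auto simp: sealed_less_iff)
    have closed: "w \<in> W \<inter> I" if "u \<in> W \<inter> I" "{u, w} \<in> Q" for u w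
      using that I(2) quasi_pairing_verts[OF q that(2)] WV by blast
    have "W \<inter> I \<noteq> {}" "W \<inter> I \<noteq> W" using tr[OF I(1)] by auto
    \<comment> \<open>Each vertex of \<open>W\<close> has a partner, which closure keeps in the
      trace.\<close>
    moreover have "\<not> is_singleton (W \<inter> I)"
    proof
      assume "is_singleton (W \<inter> I)"
      then obtain u where u: "W \<inter> I = {u}" by (auto simp: is_singleton_def)
      then obtain w where "w \<noteq> u" "{u, w} \<in> Q" using quasi_pairing_partner[OF q, of u] by blast
      then show False using closed[of u w] u by blast
    qed
    moreover have "interval_of W (W \<inter> I)"
      using I(1) WV unfolding nontrivial_interval_of_def interval_of_def by blast
    ultimately have "nontrivial_interval_of W (W \<inter> I)"
      unfolding nontrivial_interval_of_def by blast
    moreover have "\<exists>\<B> \<subseteq> Q_part Q. W \<inter> I = \<Union>\<B>"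
      by (rule iffD2[OF union_of_blocks_iff[OF q Int_lower1]], intro allI impI) (rule closed)
    ultimately show False by (rule irr[THEN notE])
  qed
next
  assume B: ?B
  have "W \<inter> I \<noteq> {} \<and> \<not> W \<subseteq> I" if I: "nontrivial_interval_of V I" for I
  proof -
    obtain u w where uw: "u \<in> I" "w \<in> V - I" "{u, w} \<in> Q"
      using B I by (auto simp: sealed_less_iff)
    then show ?thesis using quasi_pairing_verts(1,2)[OF q uw(3)] by blast
  qed
  moreover have False if J: "nontrivial_interval_of W J" and bl: "\<exists>\<B> \<subseteq> Q_part Q. J = \<Union>\<B>" for J
  proof -
    let ?I = "{v \<in> V. \<exists>i \<in> J. \<exists>j \<in> J. i \<le> v \<and> v \<le> j}"
    have JW: "J \<subseteq> W" "J \<noteq> {}" "J \<noteq> W" "\<not> is_singleton J"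
      and int: "\<And>x. x \<in> W - J \<Longrightarrow> (\<forall>i \<in> J. i < x) \<or> (\<forall>i \<in> J. x < i)"
      using J by (auto simp: nontrivial_interval_of_def interval_of_def)
    have closed: "w \<in> J" if "u \<in> J" "{u, w} \<in> Q" for u w
      using union_of_blocks_iff[OF q JW(1)] bl that by blast
    have WI: "W \<inter> ?I = J"
    proof
      show "W \<inter> ?I \<subseteq> J" using int by fastforce
      show "J \<subseteq> W \<inter> ?I" using JW(1) WV by blast
    qed
    have "interval_of V ?I"
      unfolding interval_of_def
    proof (intro conjI ballI)
      fix x assume x: "x \<in> V - ?I"
      show "(\<forall>i \<in> ?I. i < x) \<or> (\<forall>i \<in> ?I. x < i)"
      proof (rule ccontr)
        assume "\<not> ((\<forall>i \<in> ?I. i < x) \<or> (\<forall>i \<in> ?I. x < i))"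
        then obtain i j where "i \<in> ?I" "j \<in> ?I" "x \<le> i" "j \<le> x" by (meson not_less)
        then have "x \<in> ?I" using x by (auto intro: order_trans)
        then show False using x by blast
      qed
    qed blast
    moreover have "\<not> is_singleton ?I"
    proof
      assume "is_singleton ?I"
      then obtain u where "?I = {u}" by (auto simp: is_singleton_def)
      then have "J \<subseteq> {u}" using WI by blast
      then show False using JW by (auto simp: subset_singleton_iff)
    qed
    moreover have "?I \<noteq> {}" "?I \<noteq> V" using WI JW WV by blast+
    \<comment> \<open>Edges have both ends in \<open>W\<close>, and the hull meets \<open>W\<close>
      in \<open>J\<close> alone.\<close>
    moreover have "{u, w} \<notin> Q" if "u \<in> ?I" "w \<in> V - ?I" for u w
      using that closed[of u w] quasi_pairing_verts[OF q, of u w] WI by blast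
    ultimately have "sealed V (<) (\<lambda>u v. {u, v} \<in> Q) ?I"
      unfolding sealed_less_iff nontrivial_interval_of_def by blast
    then show False using B by blast
  qed
  ultimately show ?A
    unfolding transversal_mc_transitive_tournament_iff[OF fin WV]
      irreducible_quasi_pairing_def irreducible_partition_def
    using q partition_on_Q_part[OF q] by blast
qed

text \<open>A vertex outside has no neighbour in \<open>I\<close> and has all of \<open>I\<close> on
  one side.\<close>

lemma sealed_imp_nt_module:
  assumes "sealed V (<) E I" and E_sym: "\<And>u v. E u v \<Longrightarrow> E v u"
  shows "nt_module V (<) E (I :: 'a::linorder set)"
proof -
  have "(\<forall>m \<in> I. E v m \<longleftrightarrow> m < v) \<or> (\<forall>m \<in> I. E v m \<longleftrightarrow> v < m)" if "v \<in> V - I" for v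
    using assms that unfolding sealed_def by (metis less_asym)
  then show ?thesis using assms(1) unfolding nt_module_def sealed_def by blast
qed

text \<open>Deleting \<open>x\<close> cannot trivialise the module: the three vertices \<open>x\<close>, \<open>h\<close>, \<open>y\<close> lie on
  the same side of a sealed interval.\<close>

lemma sealed_imp_nt_module_delete:
  fixes V :: "'a::linorder set"
  assumes S: "sealed V (<) E I" and E_sym: "\<And>u v. E u v \<Longrightarrow> E v u"
    and xhy: "x \<in> V" "h \<in> V" "y \<in> V" "h \<noteq> x" "y \<noteq> x" "h \<noteq> y" "E x h" "E h y"
  shows "nt_module (V - {x}) (<) E (I - {x})"
proof -
  have M: "nt_module V (<) E I" using sealed_imp_nt_module[OF S E_sym] .
  have same: "x \<in> I \<longleftrightarrow> h \<in> I" "h \<in> I \<longleftrightarrow> y \<in> I"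
    using S xhy E_sym unfolding sealed_def by blast+
  have "\<not> is_singleton (I - {x})"
  proof (cases "x \<in> I")
    case True
    then have "h \<in> I - {x}" "y \<in> I - {x}" using same xhy by auto
    then show ?thesis using xhy(6) by (metis is_singletonE singletonD)
  next
    case False
    then show ?thesis using M by (simp add: nt_module_def)
  qed
  moreover have "I - {x} \<noteq> V - {x}" using M same xhy unfolding nt_module_def by blast
  moreover have "I - {x} \<noteq> {}"
    using M same xhy unfolding nt_module_def is_singleton_def by blast
  ultimately show ?thesis using M unfolding nt_module_def by blast
qed

theorem theorem3p2:
  fixes V :: "'a::linorder set" and Q :: "'a set set"
    and T :: "('a, 'a \<times> 'a) pre_digraph" and assertion1 assertion2 :: bool
  assumes "finite V"
    and "partial_quasi_pairing V Q"
    and "T = with_proj (Inv (transitive_tournament V) Q)"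
    and "assertion1 \<longleftrightarrow>
      transversal (mc (with_proj (transitive_tournament V))) (\<Union>Q) \<and>
      irreducible_quasi_pairing (\<Union>Q) Q"
    and "assertion2 \<longleftrightarrow>
      indecomposable T \<or>
      indecomposable (delete_vertex T (v_minus Q)) \<or>
      indecomposable (delete_vertex T (v_plus Q))"
  shows "(card V \<ge> 6 \<longrightarrow> (assertion1 \<longleftrightarrow> assertion2)) \<and>
    (card V = 5 \<longrightarrow> assertion2 \<longrightarrow> assertion1)"
proof -
  let ?E = "\<lambda>u v. {u, v} \<in> Q"
  obtain W where WV: "W \<subseteq> V" and q: "quasi_pairing W Q"
    using assms(2) by (auto simp: partial_quasi_pairing_def)
  have W: "\<Union>Q = W" using q by (simp add: quasi_pairing_def)
  note block = quasi_pairing_block_verts[OF q] and hat = quasi_pairing_hat_iff[OF q]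
  have a1: "assertion1 \<longleftrightarrow> (\<nexists>I. sealed V (<) ?E I)"
    using transversal_irreducible_iff_not_sealed[OF assms(1) WV q] assms(4) W by simp
  have a2: "assertion2 \<longleftrightarrow> (\<forall>M. \<not> nt_module V (<) ?E M) \<or>
      (\<forall>M. \<not> nt_module (V - {v_minus Q}) (<) ?E M) \<or> (\<forall>M. \<not> nt_module (V - {v_plus Q}) (<) ?E M)"
    unfolding assms(5) assms(3) indecomposable_def nontrivial_module_Inv nontrivial_module_delete_Inv
    by blast
  have graph: "ordered_graph V (<) ?E"
    using assms(1) by unfold_locales (auto simp: insert_commute)
  \<comment> \<open>This half serves both \<open>card V = 5\<close> and
    \<open>card V \<ge> 6\<close>: a sealed interval yields a nontrivial module in each of the three
    tournaments.\<close>
  have "assertion1" if assertion2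
    unfolding a1
  proof
    assume "\<exists>I. sealed V (<) ?E I"
    then obtain I where I: "sealed V (<) ?E I" by blast
    have sym: "?E v u" if "?E u v" for u v using that by (simp add: insert_commute)
    have "nt_module V (<) ?E I" by (rule sealed_imp_nt_module[OF I sym])
    moreover have "nt_module (V - {v_minus Q}) (<) ?E (I - {v_minus Q})"
      using block hat WV sym by (intro sealed_imp_nt_module_delete[OF I, of _ "v_hat Q" "v_plus Q"]) auto
    moreover have "nt_module (V - {v_plus Q}) (<) ?E (I - {v_plus Q})"
      using block hat WV sym by (intro sealed_imp_nt_module_delete[OF I, of _ "v_hat Q" "v_minus Q"]) auto
    ultimately show False using that a2 by blast
  qed
  moreover have assertion2 if "card V \<ge> 6" assertion1
  proof -
    interpret quasi_matching V "(<)" ?E "v_hat Q" "v_minus Q" "v_plus Q"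
    proof (intro quasi_matching.intro quasi_matching_axioms.intro)
      show "ordered_graph V (<) ?E" by (rule graph)
      show "v = w" if "u \<noteq> v_hat Q" "?E u v" "?E u w" for u v w
        using quasi_pairing_unique[OF q that] .
      show "\<not> sealed V (<) ?E I" for I using that(2) a1 by blast
    qed (use block hat WV that(1) in auto)
    show ?thesis unfolding a2 by (rule no_module_or_deletable)
  qed
  ultimately show ?thesis by blast
qed

end
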